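(* Let $T\ge 1$, let $\mathcal{K}\subseteq\mathbb{R}^n$ be a closed convex set with $\mathbf{0}\in\mathcal{K}$ and $\|\mathbf{x}-\mathbf{y}\|_2\le D$ for all $\mathbf{x},\mathbf{y}\in\mathcal{K}$, and let $f_1,\dots,f_T:\mathcal{K}\to\mathbb{R}$ be (differentiable) $\beta$-strongly convex functions over $\mathcal{K}$, $\beta>0$, with $\|\nabla f_t(\mathbf{x})\|_2\le G$ for all $\mathbf{x}\in\mathcal{K}$, $t\in[T]$. Let $d_1,\dots,d_T\ge 1$ be arbitrary integer delays and $d=\max\{d_1,\dots,d_T\}$. Let $\mathbf{x}_1,\dots,\mathbf{x}_T$ be the decisions played by Delayed OFW for strongly convex losses (defined in the context) run with parameter $\beta$. Then for every $\mathbf{x}^\ast\in\mathcal{K}$, $$\sum_{t=1}^T f_t(\mathbf{x}_t)-\sum_{t=1}^T f_t(\mathbf{x}^\ast)\le \frac{6\sqrt2\,C_2(C_1+2C_2)T^{2/3}}{\beta}+\frac{2C_2^2\ln T}{\beta}+C_1D+(C_1+C_2)\left(3dD+\frac{4\sqrt2\,dC_2}{\beta}+\frac{2dC_1}{\beta}\ln T\right),$$ where $C_1=G+\beta D$ and $C_2=G+2\beta D$.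
   Context: A function $f:\mathcal{K}\to\mathbb{R}$ is $\beta$-strongly convex over $\mathcal{K}$ if $f(\mathbf{y})\ge f(\mathbf{x})+\langle\nabla f(\mathbf{x}),\mathbf{y}-\mathbf{x}\rangle+\frac{\beta}{2}\|\mathbf{y}-\mathbf{x}\|_2^2$ for all $\mathbf{x},\mathbf{y}\in\mathcal{K}$. Delayed online convex optimization: in each round $t=1,\dots,T$ the player plays $\mathbf{x}_t\in\mathcal{K}$, then the adversary selects a loss $f_t$; the gradient $\nabla f_t(\mathbf{x}_t)$ is revealed at the end of round $t+d_t-1$. Thus at the end of round $t$ the player receives $\{\nabla f_k(\mathbf{x}_k): k\in\mathcal{F}_t\}$, where $\mathcal{F}_t=\{k\in[T]: k+d_k-1=t\}$. Notation: $[T]=\{1,\dots,T\}$. Delayed OFW for strongly convex losses (input $\beta$): choose an arbitrary $\mathbf{y}_1\in\mathcal{K}$, set $\tau=1$, $\bar{\mathbf{g}}_0=\mathbf{0}$. For $t=1,\dots,T$: play $\mathbf{x}_t=\mathbf{y}_\tau$ (with the current value of $\tau$); receive $\{\nabla f_k(\mathbf{x}_k):k\in\mathcal{F}_t\}$; for each $k\in\mathcal{F}_t$ (processed one after another, in any order) do: (i) $\bar{\mathbf{g}}_\tau=\bar{\mathbf{g}}_{\tau-1}+\nabla f_k(\mathbf{x}_k)$ and $F_\tau(\mathbf{y})=\langle\bar{\mathbf{g}}_\tau,\mathbf{y}\rangle+\sum_{i=1}^\tau\frac{\beta}{2}\|\mathbf{y}-\mathbf{y}_i\|_2^2$; (ii)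 choose $\mathbf{v}_\tau\in\operatorname{argmin}_{\mathbf{y}\in\mathcal{K}}\langle\nabla F_\tau(\mathbf{y}_\tau),\mathbf{y}\rangle$; (iii) $\mathbf{y}_{\tau+1}=\mathbf{y}_\tau+\sigma_\tau(\mathbf{v}_\tau-\mathbf{y}_\tau)$, where $\sigma_\tau\in\operatorname{argmin}_{\sigma\in[0,1]}\langle\sigma(\mathbf{v}_\tau-\mathbf{y}_\tau),\nabla F_\tau(\mathbf{y}_\tau)\rangle+\frac{\beta\tau\sigma^2}{2}\|\mathbf{v}_\tau-\mathbf{y}_\tau\|_2^2$; then set $\tau\leftarrow\tau+1$. *)

theory Defs
  imports "HOL-Analysis.Analysis"
begin

text \<open>
  \<open>has_gradient f g F\<close>: the vector \<open>g\<close> represents the derivative of \<open>f\<close>; for \<open>F = at x\<close> this is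
  \<open>GDERIV f x :> g\<close>.  With \<open>F = at x within K\<close> it makes sense for functions that are
  meaningful on \<open>K\<close> only.  In that case \<open>g\<close> need not be unique (\<open>K\<close> may have empty interior), so
  the losses below come with an explicit gradient field.
\<close>

definition has_gradient :: "('a::real_inner \<Rightarrow> real) \<Rightarrow> 'a \<Rightarrow> 'a filter \<Rightarrow> bool" where
  "has_gradient f g F \<longleftrightarrow> (f has_derivative (\<lambda>h. inner h g)) F"

definition gradient :: "('a::real_inner \<Rightarrow> real) \<Rightarrow> 'a \<Rightarrow> 'a" where
  "gradient f x = (THE g. has_gradient f g (at x))"

lemma has_gradient_at_iff: "has_gradient f g (at x) \<longleftrightarrow> (GDERIV f x :> g)"
  by (simp add: has_gradient_def gderiv_def)

lemma gradient_eqI: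
  assumes "has_gradient f g (at x)"
  shows "gradient f x = g"
  unfolding gradient_def
proof (rule the_equality)
  fix g' assume "has_gradient f g' (at x)"
  with assms have "(\<lambda>h. inner h g') = (\<lambda>h. inner h g)"
    unfolding has_gradient_def by (rule has_derivative_unique[rotated])
  then have "inner h g' = inner h g" for h
    by (rule fun_cong)
  then show "g' = g"
    by (metis inner_commute vector_eq_ldot)
qed (rule assms)

definition strongly_convex_on ::
  "real \<Rightarrow> 'a::real_inner set \<Rightarrow> ('a \<Rightarrow> real) \<Rightarrow> ('a \<Rightarrow> 'a) \<Rightarrow> bool" where
  "strongly_convex_on \<beta> K f f' \<longleftrightarrow>
     (\<forall>x\<in>K. \<forall>y\<in>K. f y \<ge> f x + inner (f' x) (y - x) + \<beta> / 2 * (norm (y - x))\<^sup>2)"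

definition arrivals :: "nat \<Rightarrow> (nat \<Rightarrow> nat) \<Rightarrow> nat \<Rightarrow> nat set" where
  "arrivals T d t = {k \<in> {1..T}. k + d k - 1 = t}"

definition surrogate :: "real \<Rightarrow> 'a::real_inner \<Rightarrow> (nat \<Rightarrow> 'a) \<Rightarrow> nat \<Rightarrow> 'a \<Rightarrow> real" where
  "surrogate \<beta> g y s z = inner g z + (\<Sum>i = 1..s. \<beta> / 2 * (norm (z - y i))\<^sup>2)"

lemma gradient_surrogate:
  "gradient (surrogate \<beta> g y s) z = g + (\<Sum>i = 1..s. \<beta> *\<^sub>R (z - y i))"
proof (rule gradient_eqI, unfold has_gradient_def)
  have "((\<lambda>z. inner g z + (\<Sum>i = 1..s. \<beta> / 2 * inner (z - y i) (z - y i))) has_derivative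
      (\<lambda>h. inner g h + (\<Sum>i = 1..s. \<beta> / 2 * (inner (z - y i) h + inner h (z - y i))))) (at z)"
    by (auto intro!: derivative_eq_intros)
  moreover have "inner g h + (\<Sum>i = 1..s. \<beta> / 2 * (inner (z - y i) h + inner h (z - y i)))
      = inner h (g + (\<Sum>i = 1..s. \<beta> *\<^sub>R (z - y i)))" for h
    by (simp add: inner_add_right inner_sum_right inner_commute[of _ h])
  ultimately show "(surrogate \<beta> g y s has_derivative
      (\<lambda>h. inner h (g + (\<Sum>i = 1..s. \<beta> *\<^sub>R (z - y i))))) (at z)"
    by (simp add: surrogate_def[abs_def] power2_norm_eq_inner)
qed

text \<open>
  One inner iteration, processing a received gradient \<open>u\<close> when the counter has the value \<open>s\<close>.
  It constrains the entries \<open>gb s\<close>, \<open>v s\<close>, \<open>\<sigma> s\<close> and \<open>y (s + 1)\<close> of the trajectory.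
\<close>

definition ofw_step ::
  "real \<Rightarrow> 'a::real_inner set \<Rightarrow> (nat \<Rightarrow> 'a) \<Rightarrow> (nat \<Rightarrow> 'a) \<Rightarrow> (nat \<Rightarrow> 'a) \<Rightarrow> (nat \<Rightarrow> real)
    \<Rightarrow> nat \<Rightarrow> 'a \<Rightarrow> bool" where
  "ofw_step \<beta> K y gb v \<sigma> s u \<longleftrightarrow>
     gb s = gb (s - 1) + u \<and>
     (let w = gradient (surrogate \<beta> (gb s) y s) (y s) in
       is_arg_min (\<lambda>z. inner w z) (\<lambda>z. z \<in> K) (v s) \<and>
       is_arg_min
         (\<lambda>r. inner (r *\<^sub>R (v s - y s)) w + \<beta> * real s * r\<^sup>2 / 2 * (norm (v s - y s))\<^sup>2)
         (\<lambda>r. r \<in> {0..1}) (\<sigma> s)) \<and>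
     y (s + 1) = y s + \<sigma> s *\<^sub>R (v s - y s)"

text \<open>
  \<open>\<tau> t\<close> is the value of the counter at the start of round \<open>t\<close>, and the list \<open>ks\<close> is the order in
  which the gradients received at the end of round \<open>t\<close> are processed.  Since the counter increases
  with every inner iteration, each entry of \<open>gb\<close>, \<open>v\<close>, \<open>\<sigma>\<close> and \<open>y\<close> is assigned at most once, so
  that a run of the algorithm is a tuple of sequences.  All choices of the algorithm (the initial
  point, the minimisers, the processing order) are left open.  The gradient fields \<open>f' t\<close> are
  evaluated at the played points only.
\<close>

definition delayed_ofw_run ::
  "real \<Rightarrow> 'a::real_inner set \<Rightarrow> nat \<Rightarrow> (nat \<Rightarrow> nat) \<Rightarrow> (nat \<Rightarrow> 'a \<Rightarrow> 'a) \<Rightarrow> (nat \<Rightarrow> 'a)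
    \<Rightarrow> (nat \<Rightarrow> 'a) \<Rightarrow> (nat \<Rightarrow> 'a) \<Rightarrow> (nat \<Rightarrow> 'a) \<Rightarrow> (nat \<Rightarrow> real) \<Rightarrow> (nat \<Rightarrow> nat) \<Rightarrow> bool" where
  "delayed_ofw_run \<beta> K T d f' x y gb v \<sigma> \<tau> \<longleftrightarrow>
     y 1 \<in> K \<and> gb 0 = 0 \<and> \<tau> 1 = 1 \<and>
     (\<forall>t\<in>{1..T}.
        x t = y (\<tau> t) \<and>
        (\<exists>ks. distinct ks \<and> set ks = arrivals T d t \<and>
              (\<forall>j<length ks. ofw_step \<beta> K y gb v \<sigma> (\<tau> t + j) (f' (ks ! j) (x (ks ! j)))) \<and>
              \<tau> (t + 1) = \<tau> t + length ks))"

end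

theory Submission
  imports Defs
begin

text \<open>
  Strong convexity reduces the regret to that of the losses
  \<open>loss s p = inner (u s) p + \<beta> / 2 * (norm (p - y s))\<^sup>2\<close>, where \<open>u s\<close> is the gradient processed at counter
  value \<open>s\<close>.  Their sum is the surrogate, whose minimiser over \<open>K\<close> (the leader) moves by \<open>O(1 / s)\<close>.
  One Frank-Wolfe step per loss keeps the surrogate gap of the iterate at \<open>O(s powr (1 / 3))\<close>, so
  that the iterate stays within \<open>O(s powr (- 1 / 3))\<close> of the leader; summing this distance gives the
  \<open>T powr (2 / 3)\<close> term.  A delayed gradient is taken at \<open>y (\<tau> k)\<close> instead of \<open>y s\<close>.  This costs the
  distance of both iterates to their leaders and the leader movement in between, and every single
  movement is charged at most \<open>dmax\<close> times, because the rounds awaiting their gradient at any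
  moment lie in a window of length \<open>dmax\<close>.  At most \<open>dmax\<close> gradients never arrive, and each of these
  rounds costs at most \<open>G * D\<close>.
\<close>

section \<open>The surrogate as a quadratic, and one Frank-Wolfe step on it\<close>

text \<open>A sum of \<open>s\<close> quadratics of curvature \<open>\<beta>\<close> has constant
  Hessian \<open>\<beta> * s\<close> times the identity, so its second-order expansion is exact.
  Growth at the minimiser and progress of a step are both read off from it.\<close>

lemma surrogate_add:
  "surrogate \<beta> g y s (x + h) =
     surrogate \<beta> g y s x + inner h (gradient (surrogate \<beta> g y s) x) + \<beta> * real s / 2 * (norm h)\<^sup>2"
proof -
  have "\<beta> / 2 * (norm (x + h - y i))\<^sup>2 =
      \<beta> / 2 * (norm (x - y i))\<^sup>2 + inner h (\<beta> *\<^sub>R (x - y i)) + \<beta> / 2 * (norm h)\<^sup>2" for i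
    by (simp add: power2_norm_eq_inner inner_add_left inner_add_right inner_diff_left
        inner_diff_right inner_commute algebra_simps)
  then have "(\<Sum>i = 1..s. \<beta> / 2 * (norm (x + h - y i))\<^sup>2) =
      (\<Sum>i = 1..s. \<beta> / 2 * (norm (x - y i))\<^sup>2 + inner h (\<beta> *\<^sub>R (x - y i)) + \<beta> / 2 * (norm h)\<^sup>2)"
    by (simp only:)
  also have "\<dots> = (\<Sum>i = 1..s. \<beta> / 2 * (norm (x - y i))\<^sup>2)
      + inner h (\<Sum>i = 1..s. \<beta> *\<^sub>R (x - y i)) + \<beta> * real s / 2 * (norm h)\<^sup>2"
    by (simp add: sum.distrib inner_sum_right)
  finally have "(\<Sum>i = 1..s. \<beta> / 2 * (norm (x + h - y i))\<^sup>2) = \<dots>" .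
  then show ?thesis
    by (simp add: surrogate_def gradient_surrogate inner_add_right inner_commute)
qed

text \<open>In the exact expansion at \<open>z\<close> the linear term is nonnegative by first-order
  optimality on the convex set \<open>K\<close>; this is checked along the segment from
  \<open>z\<close> to \<open>x\<close>.\<close>

lemma surrogate_quadratic_growth:
  assumes "convex K" and "\<beta> \<ge> 0"
    and min: "is_arg_min (surrogate \<beta> g y s) (\<lambda>x. x \<in> K) z" and "x \<in> K"
  shows "surrogate \<beta> g y s z + \<beta> * real s / 2 * (norm (x - z))\<^sup>2 \<le> surrogate \<beta> g y s x"
proof -
  define a where "a = inner (x - z) (gradient (surrogate \<beta> g y s) z)"
  define c where "c = \<beta> * real s / 2 * (norm (x - z))\<^sup>2"
  have "z \<in> K" using min by (simp add: is_arg_min_def)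
  have "c \<ge> 0" using assms by (simp add: c_def)
  have var: "0 \<le> r * a + r\<^sup>2 * c" if "0 \<le> r" "r \<le> 1" for r
  proof -
    have "z + r *\<^sub>R (x - z) = (1 - r) *\<^sub>R z + r *\<^sub>R x"
      by (simp add: algebra_simps)
    then have "z + r *\<^sub>R (x - z) \<in> K"
      using convexD_alt[OF \<open>convex K\<close> \<open>z \<in> K\<close> \<open>x \<in> K\<close> that] by simp
    then have "surrogate \<beta> g y s z \<le> surrogate \<beta> g y s (z + r *\<^sub>R (x - z))"
      using min by (simp add: is_arg_min_linorder)
    then show ?thesis
      unfolding surrogate_add a_def c_def
      by (simp add: power_mult_distrib mult_ac)
  qed
  have "a \<ge> 0"
  proof (rule ccontr)
    assume "\<not> a \<ge> 0"
    then have "a < 0" by simp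
    \<comment> \<open>Any \<open>r\<close> with \<open>r * c < - a\<close> contradicts
      \<open>var\<close>. This choice turns \<open>a + r * c\<close> into \<open>r * a < 0\<close>,
      stays at most 1, and covers \<open>c = 0\<close> without a case split.\<close>
    define r where "r = - a / (c - a)"
    have "0 < r" "r \<le> 1" using \<open>a < 0\<close> \<open>c \<ge> 0\<close> by (auto simp: r_def field_simps)
    have "r * (c - a) = - a" using \<open>a < 0\<close> \<open>c \<ge> 0\<close> by (simp add: r_def)
    then have "a + r * c = r * a" by (simp add: algebra_simps)
    moreover have "0 \<le> r * (a + r * c)"
      using var[of r] \<open>0 < r\<close> \<open>r \<le> 1\<close> by (simp add: power2_eq_square algebra_simps)
    then have "0 \<le> a + r * c" using \<open>0 < r\<close> by (simp add: zero_le_mult_iff)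
    moreover have "r * a < 0" using \<open>0 < r\<close> \<open>a < 0\<close> by (simp add: mult_pos_neg)
    ultimately show False by simp
  qed
  then show ?thesis
    using surrogate_add[of \<beta> g y s z "x - z"] by (simp add: a_def)
qed

text \<open>The line search does at least as well as any fixed step size \<open>r\<close>. At
  \<open>v s\<close> the linear term is no larger than at \<open>p\<close>, where convexity bounds
  it by the difference of the surrogate values.\<close>

lemma ofw_step_decrease:
  assumes step: "ofw_step \<beta> K y gb v \<sigma> s u" and "\<beta> \<ge> 0" and "y s \<in> K" and "p \<in> K"
    and diam: "\<And>p q. p \<in> K \<Longrightarrow> q \<in> K \<Longrightarrow> norm (p - q) \<le> D"
    and r: "0 \<le> r" "r \<le> 1"
  shows "surrogate \<beta> (gb s) y s (y (s + 1)) \<le> surrogate \<beta> (gb s) y s (y s)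
     - r * (surrogate \<beta> (gb s) y s (y s) - surrogate \<beta> (gb s) y s p) + \<beta> * real s * r\<^sup>2 / 2 * D\<^sup>2"
proof -
  let ?F = "surrogate \<beta> (gb s) y s"
  define w where "w = gradient ?F (y s)"
  have v: "v s \<in> K" "inner w (v s) \<le> inner w p"
    and \<sigma>: "inner (\<sigma> s *\<^sub>R (v s - y s)) w + \<beta> * real s * (\<sigma> s)\<^sup>2 / 2 * (norm (v s - y s))\<^sup>2
      \<le> inner (r *\<^sub>R (v s - y s)) w + \<beta> * real s * r\<^sup>2 / 2 * (norm (v s - y s))\<^sup>2"
    and y: "y (s + 1) = y s + \<sigma> s *\<^sub>R (v s - y s)"
    using step r \<open>p \<in> K\<close> by (auto simp: ofw_step_def Let_def is_arg_min_linorder w_def)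
  have "?F (y (s + 1)) = ?F (y s) + inner (\<sigma> s *\<^sub>R (v s - y s)) w
      + \<beta> * real s * (\<sigma> s)\<^sup>2 / 2 * (norm (v s - y s))\<^sup>2"
    unfolding y surrogate_add w_def by (simp add: power_mult_distrib)
  also have "\<dots> \<le> ?F (y s) + r * inner (v s - y s) w + \<beta> * real s * r\<^sup>2 / 2 * (norm (v s - y s))\<^sup>2"
    using \<sigma> by simp
  finally have 1: "?F (y (s + 1)) \<le> \<dots>" .
  have "inner (v s - y s) w \<le> inner (p - y s) w"
    using v by (simp add: inner_diff_left inner_diff_right inner_commute[of _ w])
  also have "\<dots> \<le> ?F p - ?F (y s)"
    using surrogate_add[of \<beta> "gb s" y s "y s" "p - y s"] \<open>\<beta> \<ge> 0\<close> by (simp add: w_def)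
  finally have 2: "r * inner (v s - y s) w \<le> r * (?F p - ?F (y s))"
    using r by (intro mult_left_mono)
  have "(norm (v s - y s))\<^sup>2 \<le> D\<^sup>2"
    using diam[OF v(1) \<open>y s \<in> K\<close>] by (simp add: power_mono)
  then have 3: "\<beta> * real s * r\<^sup>2 / 2 * (norm (v s - y s))\<^sup>2 \<le> \<beta> * real s * r\<^sup>2 / 2 * D\<^sup>2"
    using \<open>\<beta> \<ge> 0\<close> by (intro mult_left_mono) auto
  show ?thesis using 1 2 3 by (simp add: algebra_simps)
qed

text \<open>Each iterate is a convex combination of its predecessor and a point of \<open>K\<close>.
  This stands outside the locale below because the bound on the processed gradients becomes
  available only once the played points are known to lie in \<open>K\<close>.\<close>

lemma ofw_iterate_in:
  assumes "convex K" "y 1 \<in> K"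
    and step: "\<And>s. s \<in> {1..m} \<Longrightarrow> ofw_step \<beta> K y gb v \<sigma> s (u s)"
  shows "s \<in> {1..m + 1} \<Longrightarrow> y s \<in> K"
proof (induction s)
  case (Suc s)
  show ?case
  proof (cases "s = 0")
    case False
    then have s: "s \<in> {1..m}" using Suc.prems by auto
    then have "y s \<in> K" using Suc.IH by simp
    have "v s \<in> K" "0 \<le> \<sigma> s" "\<sigma> s \<le> 1" and y: "y (Suc s) = y s + \<sigma> s *\<^sub>R (v s - y s)"
      using step[OF s] by (auto simp: ofw_step_def Let_def is_arg_min_def)
    then show ?thesis
      using convexD_alt[OF \<open>convex K\<close> \<open>y s \<in> K\<close> \<open>v s \<in> K\<close>, of "\<sigma> s"] unfolding y
      by (simp add: algebra_simps)
  qed (use assms in simp)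
qed simp

section \<open>Numerical estimates\<close>

text \<open>Telescoping with \<open>ln r <= r - 1\<close> at \<open>r = n / (n + 1)\<close>.
  Starting at 2 avoids an additive constant.\<close>

lemma sum_inverse_le_ln:
  assumes "1 \<le> n"
  shows "(\<Sum>s = 2..n. 1 / real s) \<le> ln (real n)"
  using assms
proof (induction n rule: dec_induct)
  case (step n)
  have "ln (real n / real (Suc n)) \<le> real n / real (Suc n) - 1"
    using step by (intro ln_le_minus_one) auto
  also have "\<dots> = - (1 / real (Suc n))" by (simp add: field_simps)
  finally have "1 / real (Suc n) \<le> ln (real (Suc n)) - ln (real n)"
    using step by (simp add: ln_div)
  then show ?case using step by simp
qed simp

text \<open>Each summand is at most the increment of the right-hand side; in terms of cube roots
  this is a polynomial inequality.\<close>

lemma sum_powr_minus_third_le: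
  "(\<Sum>s = 1..n. real s powr (- 1 / 3)) \<le> 3 / 2 * real n powr (2 / 3)"
proof (induction n)
  case (Suc n)
  define p where "p = root 3 (real n)"
  define q where "q = root 3 (real (Suc n))"
  have "p \<ge> 0" "q > 0" and pq: "q ^ 3 = p ^ 3 + 1" by (auto simp: p_def q_def)
  have "real (Suc n) powr (- 1 / 3) = 1 / q"
    by (simp add: q_def root_powr_inverse powr_minus field_simps)
  moreover have "root 3 (real k) ^ 2 = real k powr (2 / 3)" for k
    by (cases "k = 0") (auto simp: root_powr_inverse powr_powr simp flip: powr_numeral)
  then have "real n powr (2 / 3) = p\<^sup>2" "real (Suc n) powr (2 / 3) = q\<^sup>2"
    unfolding p_def q_def by (simp_all only:)
  moreover have "1 / q \<le> 3 / 2 * q\<^sup>2 - 3 / 2 * p\<^sup>2"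
  proof -
    \<comment> \<open>This is the arithmetic-geometric mean inequality
      \<open>3 * p^2 * q <= q^3 + 2 * p^3\<close> in factored form.\<close>
    have "0 \<le> (q - p)\<^sup>2 * (q + 2 * p)" using \<open>p \<ge> 0\<close> \<open>q > 0\<close> by simp
    also have "\<dots> = 3 * (q ^ 3 - p\<^sup>2 * q) - 2 * (q ^ 3 - p ^ 3)"
      by (simp add: power2_eq_square power3_eq_cube algebra_simps)
    finally have "2 \<le> 3 * (q ^ 3 - p\<^sup>2 * q)" using pq by simp
    then show ?thesis using \<open>q > 0\<close> by (simp add: field_simps power2_eq_square power3_eq_cube)
  qed
  ultimately show ?case using Suc.IH by simp
qed simp

text \<open>The induction step of \<open>leader_gap\<close> divided by
  \<open>C2^2 / \<beta>\<close>, with \<open>p\<close> and \<open>q\<close> the cube roots of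
  consecutive integers. The gain \<open>16 * p / q^2\<close> is at least \<open>10 / p\<close>,
  while the three error terms sum to at most \<open>9 / p\<close>.\<close>

lemma cube_root_step:
  fixes p q :: real
  assumes "p \<ge> 1" "q > 0" and pq: "q ^ 3 = p ^ 3 + 1"
  shows "16 * p + 4 * sqrt 2 / p + 2 / q ^ 3 - 16 * p / q\<^sup>2 + 1 / (8 * q) \<le> 16 * q"
proof -
  have "p ^ 3 \<ge> 1" using assms by simp
  have "p \<le> q" using pq assms by (intro power_le_imp_le_base[of p 2 q]) (auto simp: numeral_3_eq_3)
  \<comment> \<open>Here \<open>q^3 <= 2 * p^3\<close>, and 1.26 lies just above the cube root of 2;
    its square is below 1.6 = 16 / 10.\<close>
  have "q ^ 3 \<le> (1.26 * p) ^ 3" using pq \<open>p ^ 3 \<ge> 1\<close> by (simp add: power_mult_distrib power3_eq_cube)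
  then have "q \<le> 1.26 * p" using assms by (intro power_le_imp_le_base[of q 2]) (auto simp: numeral_3_eq_3)
  then have "q\<^sup>2 \<le> (1.26 * p)\<^sup>2" using assms by (intro power_mono) auto
  also have "\<dots> = 1.5876 * p\<^sup>2" by (simp add: power2_eq_square)
  also have "\<dots> \<le> 1.6 * p\<^sup>2" by (intro mult_right_mono) auto
  finally have "q\<^sup>2 \<le> 1.6 * p\<^sup>2" .
  then have 1: "16 * p / q\<^sup>2 \<ge> 10 / p" using assms by (simp add: field_simps power2_eq_square)
  have "sqrt 2 \<le> 1.5" by (rule real_le_lsqrt) (auto simp: power2_eq_square)
  then have 2: "4 * sqrt 2 / p \<le> 6 / p" using assms by (intro divide_right_mono) auto
  have "p * 1 \<le> p * (p * p)" using \<open>p \<ge> 1\<close> mult_mono[of 1 p 1 p] by (intro mult_left_mono) auto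
  then have "p \<le> q ^ 3" using pq by (simp add: power3_eq_cube)
  then have 3: "2 / q ^ 3 \<le> 2 / p" using assms by (intro divide_left_mono) auto
  have 4: "1 / (8 * q) \<le> 1 / p" using assms \<open>q \<ge> p\<close> by (intro divide_left_mono) auto
  have "6 / p + 2 / p - 10 / p + 1 / p \<le> 0" using assms by (simp add: field_simps)
  then show ?thesis using 1 2 3 4 \<open>q \<ge> p\<close> by linarith
qed

section \<open>The trajectory indexed by the counter, without reference to delays\<close>

locale ofw_trajectory =
  fixes \<beta> D G :: real and K :: "'a::euclidean_space set" and m :: nat
    and y gb v u :: "nat \<Rightarrow> 'a" and \<sigma> :: "nat \<Rightarrow> real"
  assumes beta_pos: "\<beta> > 0" and closed_K: "closed K" and convex_K: "convex K"
    and diam: "\<And>p q. p \<in> K \<Longrightarrow> q \<in> K \<Longrightarrow> norm (p - q) \<le> D"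
    and y_1: "y 1 \<in> K" and gb_0: "gb 0 = 0"
    and step: "\<And>s. s \<in> {1..m} \<Longrightarrow> ofw_step \<beta> K y gb v \<sigma> s (u s)"
    and u_bound: "\<And>s. s \<in> {1..m} \<Longrightarrow> norm (u s) \<le> G"
    and G_nonneg: "0 \<le> G"
begin

abbreviation F :: "nat \<Rightarrow> 'a \<Rightarrow> real" where
  "F s \<equiv> surrogate \<beta> (gb s) y s"

definition loss :: "nat \<Rightarrow> 'a \<Rightarrow> real" where
  "loss s p = inner (u s) p + \<beta> / 2 * (norm (p - y s))\<^sup>2"

text \<open>The follow-the-leader point for the losses before \<open>s\<close>, indexed so that it
  is the companion of \<open>y s\<close>. The empty surrogate is constant, so at the start
  \<open>y 1\<close> is itself a minimiser; choosing it makes the initial distance between iterate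
  and leader zero.\<close>

definition leader :: "nat \<Rightarrow> 'a" where
  "leader s = (if s \<le> 1 then y 1 else SOME z. is_arg_min (F (s - 1)) (\<lambda>p. p \<in> K) z)"

abbreviation C1 :: real where "C1 \<equiv> G + \<beta> * D"
abbreviation C2 :: real where "C2 \<equiv> G + 2 * \<beta> * D"

lemma D_nonneg: "0 \<le> D"
  using diam[OF y_1 y_1] by simp

lemma F_0: "F 0 p = 0"
  by (simp add: surrogate_def gb_0)

lemma F_Suc: "Suc s \<le> m \<Longrightarrow> F (Suc s) p = F s p + loss (Suc s) p"
  using step[of "Suc s"] by (simp add: ofw_step_def surrogate_def loss_def inner_add_left)

lemma y_in: "s \<in> {1..m + 1} \<Longrightarrow> y s \<in> K"
  by (rule ofw_iterate_in[OF convex_K y_1 step])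

lemma leader_arg_min: "is_arg_min (F s) (\<lambda>p. p \<in> K) (leader (Suc s))"
proof (cases "s = 0")
  case True
  then show ?thesis using y_1 by (simp add: leader_def is_arg_min_def F_0)
next
  case False
  have "bounded K"
    using diam[OF _ y_1] by (auto simp: bounded_any_center[where a = "y 1"] dist_norm norm_minus_commute)
  then have "compact K" using closed_K by (simp add: compact_eq_bounded_closed)
  moreover have "continuous_on K (F s)"
    unfolding surrogate_def by (intro continuous_intros)
  ultimately obtain z where "z \<in> K" "\<And>p. p \<in> K \<Longrightarrow> F s z \<le> F s p"
    using continuous_attains_inf[of K "F s"] y_1 by blast
  then have "is_arg_min (F s) (\<lambda>p. p \<in> K) z" by (simp add: is_arg_min_linorder)
  then show ?thesis using False by (auto simp: leader_def intro: someI)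
qed

lemma leader_1: "leader 1 = y 1"
  by (simp add: leader_def)

lemma leader_in: "leader s \<in> K"
  using leader_arg_min[of "s - 1"] y_1 by (cases s) (auto simp: is_arg_min_def leader_def)

lemma leader_growth:
  "p \<in> K \<Longrightarrow> F s (leader (Suc s)) + \<beta> * real s / 2 * (norm (p - leader (Suc s)))\<^sup>2 \<le> F s p"
  using surrogate_quadratic_growth[OF convex_K _ leader_arg_min] beta_pos by simp

lemma leader_le: "p \<in> K \<Longrightarrow> F s (leader (Suc s)) \<le> F s p"
  using leader_arg_min[of s] by (simp add: is_arg_min_linorder)

lemma inner_u_le: "s \<in> {1..m} \<Longrightarrow> inner (u s) p \<le> G * norm p"
  by (meson norm_cauchy_schwarz mult_right_mono norm_ge_zero order_trans u_bound)

text \<open>A difference of squares whose sum factor is at most \<open>2 * D\<close>; the summand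
  \<open>\<beta> * D\<close> of \<open>C1\<close> comes from here.\<close>

lemma sq_dist_diff_le:
  assumes "p \<in> K" "q \<in> K" "z \<in> K"
  shows "\<beta> / 2 * (norm (p - z))\<^sup>2 - \<beta> / 2 * (norm (q - z))\<^sup>2 \<le> \<beta> * D * norm (p - q)"
proof -
  have "(norm (p - z))\<^sup>2 - (norm (q - z))\<^sup>2
      = (norm (p - z) - norm (q - z)) * (norm (p - z) + norm (q - z))"
    by (simp add: power2_eq_square algebra_simps)
  also have "\<dots> \<le> norm (p - q) * (D + D)"
  proof (rule mult_mono)
    show "norm (p - z) - norm (q - z) \<le> norm (p - q)"
      using norm_triangle_ineq2[of "p - z" "q - z"] by simp
    show "norm (p - z) + norm (q - z) \<le> D + D"
      using diam assms by (intro add_mono) auto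
  qed auto
  finally have "\<beta> / 2 * ((norm (p - z))\<^sup>2 - (norm (q - z))\<^sup>2) \<le> \<beta> / 2 * (norm (p - q) * (D + D))"
    using beta_pos by (intro mult_left_mono) auto
  then show ?thesis by (simp add: algebra_simps)
qed

lemma loss_diff_le:
  assumes "s \<in> {1..m}" "p \<in> K" "q \<in> K"
  shows "loss s p - loss s q \<le> C1 * norm (p - q)"
proof -
  have "y s \<in> K" using assms y_in by auto
  then show ?thesis
    using inner_u_le[OF assms(1), of "p - q"] sq_dist_diff_le[OF assms(2,3), of "y s"]
    by (simp add: loss_def inner_diff_right distrib_right)
qed

text \<open>Moves the strong-convexity bound from the point where a gradient was taken to the
  iterate at which it is processed.\<close>

lemma linear_minus_quadratic_shift:
  assumes "s \<in> {1..m}" "p \<in> K" "q \<in> K" "z \<in> K"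
  shows "inner (u s) (p - z) - \<beta> / 2 * (norm (p - z))\<^sup>2
    \<le> inner (u s) (q - z) - \<beta> / 2 * (norm (q - z))\<^sup>2 + C1 * norm (p - q)"
  using inner_u_le[OF assms(1), of "p - q"] sq_dist_diff_le[OF assms(3,2,4)]
  by (simp add: inner_diff_right distrib_right norm_minus_commute)

text \<open>\<open>y s\<close> is the centre of the quadratic part, which vanishes there and only
  helps at \<open>p\<close>; hence the constant is \<open>G\<close> instead of
  \<open>C1\<close>.\<close>

lemma loss_at_y_diff_le:
  assumes "s \<in> {1..m}"
  shows "loss s (y s) - loss s p \<le> G * norm (y s - p)"
proof -
  have "0 \<le> \<beta> / 2 * (norm (p - y s))\<^sup>2" using beta_pos by simp
  then show ?thesis
    using inner_u_le[OF assms, of "y s - p"] by (simp add: loss_def inner_diff_right)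
qed

section \<open>Movement of the leaders and distance of the iterates to them\<close>

text \<open>Growth of \<open>F s\<close> with curvature \<open>\<beta> * s\<close> at the new leader
  is set against the single new loss, which is \<open>C1\<close>-Lipschitz on \<open>K\<close>,
  since the old leader is optimal for the rest. One factor of the distance cancels.\<close>

lemma leader_stable:
  assumes "s \<in> {1..m}"
  shows "norm (leader s - leader (Suc s)) \<le> 2 * C1 / (\<beta> * real s)"
proof -
  obtain r where r: "s = Suc r" using assms by (cases s) auto
  let ?a = "leader s" and ?b = "leader (Suc s)"
  let ?n = "norm (?a - ?b)"
  have "?a \<in> K" "?b \<in> K" using leader_in r by auto
  have "F s ?b + \<beta> * real s / 2 * ?n\<^sup>2 \<le> F s ?a" by (rule leader_growth) fact
  moreover have "F s ?a - F s ?b = F r ?a - F r ?b + (loss s ?a - loss s ?b)"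
    using F_Suc[of r] assms by (simp add: r)
  moreover have "F r ?a \<le> F r ?b" using leader_le[OF \<open>?b \<in> K\<close>] by (simp add: r)
  moreover have "loss s ?a - loss s ?b \<le> C1 * ?n"
    by (rule loss_diff_le) fact+
  ultimately have "\<beta> * real s / 2 * ?n * ?n \<le> C1 * ?n" by (simp add: power2_eq_square)
  then have "?n = 0 \<or> \<beta> * real s / 2 * ?n \<le> C1"
    by (metis mult_right_le_imp_le norm_ge_zero order_le_less)
  then show ?thesis
  proof
    assume "?n = 0"
    then show ?thesis using G_nonneg D_nonneg beta_pos by simp
  next
    assume "\<beta> * real s / 2 * ?n \<le> C1"
    then show ?thesis using beta_pos assms by (simp add: field_simps)
  qed
qed

lemma norm_leader_diff_le:
  "a \<le> b \<Longrightarrow> norm (leader a - leader b) \<le> (\<Sum>i = a..<b. norm (leader i - leader (Suc i)))"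
proof (induction b rule: dec_induct)
  case (step b)
  then show ?case
    using norm_triangle_ineq[of "leader a - leader b" "leader b - leader (Suc b)"] by simp
qed simp

text \<open>Quadratic growth turns a gap in value into a distance, with \<open>4 * sqrt 2\<close>
  the root of \<open>2 * 16\<close>. The gap is a premise because the induction for
  \<open>leader_gap\<close> applies this to its own hypothesis.\<close>

lemma norm_y_leader_le:
  assumes s: "s \<in> {1..m}"
    and gap: "F s (y (Suc s)) - F s (leader (Suc s)) \<le> 16 * C2\<^sup>2 / \<beta> * root 3 (real s)"
  shows "norm (y (Suc s) - leader (Suc s)) \<le> 4 * sqrt 2 * C2 / (\<beta> * root 3 (real s))"
proof (rule power2_le_imp_le)
  define p where "p = root 3 (real s)"
  have "p > 0" "p ^ 3 = real s" using s by (auto simp: p_def)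
  let ?n = "norm (y (Suc s) - leader (Suc s))"
  have "F s (leader (Suc s)) + \<beta> * real s / 2 * ?n\<^sup>2 \<le> F s (y (Suc s))"
    using s by (intro leader_growth y_in) auto
  then have "\<beta> * p ^ 3 / 2 * ?n\<^sup>2 \<le> 16 * C2\<^sup>2 / \<beta> * p"
    using gap unfolding \<open>p ^ 3 = real s\<close> p_def[symmetric] by linarith
  then have "p * (\<beta> * p * ?n)\<^sup>2 \<le> p * (32 * C2\<^sup>2)"
    using beta_pos by (simp add: field_simps eval_nat_numeral)
  then have "(\<beta> * p * ?n)\<^sup>2 \<le> 32 * C2\<^sup>2" using \<open>p > 0\<close> by simp
  moreover have "(4 * sqrt 2 * C2 / (\<beta> * p))\<^sup>2 = 32 * C2\<^sup>2 / (\<beta> * p)\<^sup>2"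
    by (simp add: power_divide power_mult_distrib)
  ultimately show "?n\<^sup>2 \<le> (4 * sqrt 2 * C2 / (\<beta> * root 3 (real s)))\<^sup>2"
    using beta_pos \<open>p > 0\<close> unfolding p_def[symmetric]
    by (simp add: power_mult_distrib pos_le_divide_eq mult_ac)
qed (use beta_pos G_nonneg D_nonneg in simp)

text \<open>
  The Frank-Wolfe step is compared with the step size \<open>s powr (-2/3)\<close>, which balances the drift of
  the leader against the curvature term.
\<close>

lemma leader_gap:
  assumes "s \<in> {1..m}"
  shows "F s (y (Suc s)) - F s (leader (Suc s)) \<le> 16 * C2\<^sup>2 / \<beta> * root 3 (real s)"
proof -
  let ?a = "C2\<^sup>2 / \<beta>"
  \<comment> \<open>From \<open>2 * \<beta> * D <= C2\<close>. Every term below becomes a multiple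
    of \<open>C2^2 / \<beta>\<close>, leaving a purely numerical inequality.\<close>
  have bD: "\<beta> * D\<^sup>2 \<le> ?a / 4"
  proof -
    have "(2 * \<beta> * D)\<^sup>2 \<le> C2\<^sup>2" using G_nonneg beta_pos D_nonneg by (intro power_mono) auto
    then show ?thesis using beta_pos by (simp add: field_simps power2_eq_square)
  qed
  have "?a \<ge> 0" using beta_pos by simp
  show ?thesis using assms
  proof (induction s)
    case (Suc n)
    let ?s = "Suc n"
    let ?z = "leader (Suc ?s)" and ?H = "F ?s (y ?s) - F ?s (leader (Suc ?s))"
    have yK: "y ?s \<in> K" using y_in Suc.prems by simp
    have dec: "F ?s (y (Suc ?s)) - F ?s ?z \<le> ?H - r * ?H + r\<^sup>2 * real ?s * ?a / 8"
      if "0 \<le> r" "r \<le> 1" for r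
    proof -
      have "real ?s * r\<^sup>2 / 2 * (\<beta> * D\<^sup>2) \<le> real ?s * r\<^sup>2 / 2 * (?a / 4)"
        by (rule mult_left_mono[OF bD]) simp
      then have "\<beta> * real ?s * r\<^sup>2 / 2 * D\<^sup>2 \<le> r\<^sup>2 * real ?s * ?a / 8"
        by (simp add: mult_ac)
      moreover have "F ?s (y (?s + 1)) \<le> F ?s (y ?s) - r * ?H + \<beta> * real ?s * r\<^sup>2 / 2 * D\<^sup>2"
        using ofw_step_decrease[OF step[OF Suc.prems] _ yK leader_in diam that] beta_pos by simp
      ultimately show ?thesis unfolding Suc_eq_plus1[symmetric] by linarith
    qed
    show ?case
    proof (cases "n = 0")
      \<comment> \<open>For the first loss the full step \<open>r = 1\<close> cancels the old gap,
        so only the curvature term remains.\<close>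
      case True
      then show ?thesis using dec[of 1] \<open>?a \<ge> 0\<close> by simp
    next
      case False
      then have n: "n \<in> {1..m}" using Suc.prems by auto
      define p where "p = root 3 (real n)"
      define q where "q = root 3 (real ?s)"
      have p3: "p ^ 3 = real n" and q3: "q ^ 3 = real ?s" by (auto simp: p_def q_def)
      have "p \<ge> 1" "q \<ge> 1" using False by (auto simp: p_def q_def)
      let ?h = "F n (y ?s) - F n (leader ?s)"
      have h: "?h \<le> 16 * C2\<^sup>2 / \<beta> * p" using Suc.IH n by (simp add: p_def)
      have E: "norm (y ?s - leader ?s) \<le> 4 * sqrt 2 * C2 / (\<beta> * p)"
        unfolding p_def using norm_y_leader_le[OF n] Suc.IH[OF n] .
      have "norm (y ?s - ?z) \<le> norm (y ?s - leader ?s) + norm (leader ?s - ?z)"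
        using norm_triangle_ineq[of "y ?s - leader ?s" "leader ?s - ?z"] by simp
      also have "\<dots> \<le> 4 * sqrt 2 * C2 / (\<beta> * p) + 2 * C1 / (\<beta> * real ?s)"
        by (intro add_mono E leader_stable Suc.prems)
      also have "\<dots> \<le> 4 * sqrt 2 * C2 / (\<beta> * p) + 2 * C2 / (\<beta> * real ?s)"
        using beta_pos D_nonneg by (intro add_left_mono divide_right_mono) auto
      finally have "G * norm (y ?s - ?z) \<le> C2 * (4 * sqrt 2 * C2 / (\<beta> * p) + 2 * C2 / (\<beta> * real ?s))"
        using G_nonneg beta_pos D_nonneg by (intro mult_mono) auto
      also have "\<dots> = ?a * (4 * sqrt 2 / p + 2 / q ^ 3)"
      proof -
        have "c * (4 * sqrt 2 * c / (\<beta> * p) + 2 * c / (\<beta> * n')) = c\<^sup>2 / \<beta> * (4 * sqrt 2 / p + 2 / n')"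
          for c n' :: real
          by (simp add: power2_eq_square distrib_left mult_ac)
        then show ?thesis unfolding q3 .
      qed
      finally have drift: "G * norm (y ?s - ?z) \<le> ?a * (4 * sqrt 2 / p + 2 / q ^ 3)" .
      \<comment> \<open>The old gap, plus a term that is at most 0 by optimality of the old leader,
        plus the effect of the new loss.\<close>
      have "?H = ?h + (F n (leader ?s) - F n ?z) + (loss ?s (y ?s) - loss ?s ?z)"
        using F_Suc[of n] Suc.prems by simp
      also have "\<dots> \<le> 16 * C2\<^sup>2 / \<beta> * p + 0 + ?a * (4 * sqrt 2 / p + 2 / q ^ 3)"
        using h leader_le[OF leader_in[of "Suc ?s"], of n] loss_at_y_diff_le[OF Suc.prems, of ?z] drift
        by linarith
      also have "\<dots> = ?a * (16 * p + 4 * sqrt 2 / p + 2 / q ^ 3)" by (simp add: algebra_simps)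
      finally have H: "?H \<le> ?a * (16 * p + 4 * sqrt 2 / p + 2 / q ^ 3)" .
      define r where "r = 1 / q\<^sup>2"
      have r: "0 \<le> r" "r \<le> 1" using \<open>q \<ge> 1\<close> by (auto simp: r_def)
      have "F ?s (y (Suc ?s)) - F ?s ?z \<le> (1 - r) * ?H + r\<^sup>2 * real ?s * ?a / 8"
        using dec[OF r] by (simp add: algebra_simps)
      also have "\<dots> \<le> (1 - r) * (?a * (16 * p + 4 * sqrt 2 / p + 2 / q ^ 3)) + r\<^sup>2 * real ?s * ?a / 8"
        using H r by (intro add_right_mono mult_left_mono) auto
      also have "\<dots> = ?a * ((1 - r) * (16 * p + 4 * sqrt 2 / p + 2 / q ^ 3) + r\<^sup>2 * q ^ 3 / 8)"
      proof -
        have "(1 - r) * (a * e) + r\<^sup>2 * b * a / 8 = a * ((1 - r) * e + r\<^sup>2 * b / 8)" for a b e :: real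
          by (simp add: algebra_simps)
        then show ?thesis unfolding q3 .
      qed
      also have "r\<^sup>2 * q ^ 3 / 8 = 1 / (8 * q)"
        using \<open>q \<ge> 1\<close> by (simp add: r_def field_simps eval_nat_numeral)
      also have "?a * ((1 - r) * (16 * p + 4 * sqrt 2 / p + 2 / q ^ 3) + 1 / (8 * q)) \<le> ?a * (16 * q)"
      proof (rule mult_left_mono)
        \<comment> \<open>Only the main term \<open>16 * p\<close> needs the contraction factor; for
          the small terms \<open>1 - r <= 1\<close> suffices.\<close>
        have "(1 - r) * (16 * p + 4 * sqrt 2 / p + 2 / q ^ 3)
            = 16 * p - r * (16 * p) + (1 - r) * (4 * sqrt 2 / p + 2 / q ^ 3)"
          by (simp add: algebra_simps)
        also have "\<dots> \<le> 16 * p - r * (16 * p) + 1 * (4 * sqrt 2 / p + 2 / q ^ 3)"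
          using r \<open>p \<ge> 1\<close> \<open>q \<ge> 1\<close> by (intro add_left_mono mult_right_mono) auto
        finally show "(1 - r) * (16 * p + 4 * sqrt 2 / p + 2 / q ^ 3) + 1 / (8 * q) \<le> 16 * q"
          using cube_root_step[OF \<open>p \<ge> 1\<close>, of q] \<open>q \<ge> 1\<close> p3 q3 by (simp add: r_def)
      qed fact
      finally show ?thesis by (simp add: q_def mult_ac)
    qed
  qed simp
qed

lemma norm_y_leader:
  assumes "s \<in> {1..m}"
  shows "norm (y (Suc s) - leader (Suc s)) \<le> 4 * sqrt 2 * C2 / \<beta> * real s powr (- 1 / 3)"
proof -
  have "real s powr (- 1 / 3) = 1 / root 3 (real s)"
    using assms by (simp add: root_powr_inverse powr_minus field_simps)
  then show ?thesis
    using norm_y_leader_le[OF assms leader_gap[OF assms]] by simp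
qed

section \<open>Regret of the trajectory on the processed losses\<close>

text \<open>The classical be-the-leader argument: the comparison point stays arbitrary in the
  induction so that the hypothesis can be applied at the next leader.\<close>

lemma be_the_leader:
  assumes "p \<in> K" "n \<le> m"
  shows "(\<Sum>s = 1..n. loss s (leader (Suc s))) \<le> F n p"
  using assms
proof (induction n arbitrary: p)
  case (Suc n)
  have "(\<Sum>s = 1..Suc n. loss s (leader (Suc s)))
      \<le> F n (leader (Suc (Suc n))) + loss (Suc n) (leader (Suc (Suc n)))"
    using Suc.IH[OF leader_in] Suc.prems by simp
  also have "\<dots> = F (Suc n) (leader (Suc (Suc n)))" using F_Suc[of n] Suc.prems by simp
  also have "\<dots> \<le> F (Suc n) p" using Suc.prems by (intro leader_le)
  finally show ?case .
qed (simp add: F_0)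

lemma F_eq_sum_loss: "n \<le> m \<Longrightarrow> F n p = (\<Sum>s = 1..n. loss s p)"
  by (induction n) (auto simp: F_0 F_Suc)

text \<open>The summand on the left is exactly \<open>loss s (y s) - loss s p\<close>. Be-the-leader
  replaces \<open>p\<close> by \<open>leader (Suc s)\<close>, and the remaining distance is split at
  \<open>leader s\<close>.\<close>

lemma sum_loss_regret:
  assumes "p \<in> K"
  shows "(\<Sum>s = 1..m. inner (u s) (y s - p) - \<beta> / 2 * (norm (y s - p))\<^sup>2)
    \<le> G * ((\<Sum>s = 1..m. norm (y s - leader s)) + (\<Sum>s = 1..m. norm (leader s - leader (Suc s))))"
proof -
  have "(\<Sum>s = 1..m. inner (u s) (y s - p) - \<beta> / 2 * (norm (y s - p))\<^sup>2)
      = (\<Sum>s = 1..m. loss s (y s)) - (\<Sum>s = 1..m. loss s p)"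
    unfolding sum_subtractf[symmetric]
    by (intro sum.cong) (auto simp: loss_def inner_diff_right norm_minus_commute)
  also have "\<dots> \<le> (\<Sum>s = 1..m. loss s (y s)) - (\<Sum>s = 1..m. loss s (leader (Suc s)))"
    using be_the_leader[OF assms order_refl] F_eq_sum_loss[of m p] by simp
  also have "\<dots> \<le> (\<Sum>s = 1..m. G * (norm (y s - leader s) + norm (leader s - leader (Suc s))))"
    unfolding sum_subtractf[symmetric]
  proof (rule sum_mono)
    fix s assume s: "s \<in> {1..m}"
    have "norm (y s - leader (Suc s)) \<le> norm (y s - leader s) + norm (leader s - leader (Suc s))"
      using norm_triangle_ineq[of "y s - leader s" "leader s - leader (Suc s)"] by simp
    then show "loss s (y s) - loss s (leader (Suc s))
        \<le> G * (norm (y s - leader s) + norm (leader s - leader (Suc s)))"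
      using loss_at_y_diff_le[OF s, of "leader (Suc s)"] G_nonneg
      by (meson mult_left_mono order_trans)
  qed
  also have "\<dots> = G * ((\<Sum>s = 1..m. norm (y s - leader s))
      + (\<Sum>s = 1..m. norm (leader s - leader (Suc s))))"
    by (simp add: sum.distrib sum_distrib_left distrib_left)
  finally show ?thesis .
qed

lemma sum_norm_y_leader:
  assumes "m \<le> n"
  shows "(\<Sum>s = 1..m. norm (y s - leader s)) \<le> 6 * sqrt 2 * C2 / \<beta> * real n powr (2 / 3)"
proof -
  let ?k = "4 * sqrt 2 * C2 / \<beta>"
  have k: "0 \<le> ?k" using beta_pos G_nonneg D_nonneg by simp
  \<comment> \<open>One more term is added so that, after dropping the zero term at 1, the index
    shift gives the range of \<open>norm_y_leader\<close>.\<close>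
  have "(\<Sum>s = 1..m. norm (y s - leader s)) \<le> (\<Sum>s = 1..Suc m. norm (y s - leader s))"
    by simp
  also have "\<dots> = (\<Sum>s = 1..m. norm (y (Suc s) - leader (Suc s)))"
    using leader_1 by (simp add: sum.atLeast_Suc_atMost[of 0] sum.shift_bounds_cl_Suc_ivl del: sum.cl_ivl_Suc)
  also have "\<dots> \<le> (\<Sum>s = 1..m. ?k * real s powr (- 1 / 3))"
    by (intro sum_mono norm_y_leader)
  also have "\<dots> = ?k * (\<Sum>s = 1..m. real s powr (- 1 / 3))" by (simp add: sum_distrib_left)
  also have "\<dots> \<le> ?k * (3 / 2 * real n powr (2 / 3))"
    using sum_powr_minus_third_le[of m] powr_mono2[of "2 / 3" "real m" "real n"] assms
    by (intro mult_left_mono[OF _ k]) auto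
  also have "4 * a * b / \<beta> * (3 / 2 * e) = 6 * a * b / \<beta> * e" for a b e by simp
  finally show ?thesis .
qed

lemma sum_norm_leader_diff:
  assumes "m \<le> n" "1 \<le> n"
  shows "(\<Sum>s = 1..m. norm (leader s - leader (Suc s))) \<le> D + 2 * C1 / \<beta> * ln (real n)"
proof -
  have k: "0 \<le> 2 * C1 / \<beta>" using beta_pos G_nonneg D_nonneg by simp
  \<comment> \<open>The first movement is charged to the diameter, so that the harmonic sum starts
    at 2.\<close>
  have "(\<Sum>s = 1..m. norm (leader s - leader (Suc s)))
      \<le> (\<Sum>s = 1..n. if s = 1 then D else 2 * C1 / (\<beta> * real s))"
  proof (rule sum_le_included[where i = id])
    show "\<forall>s\<in>{1..m}. \<exists>s'\<in>{1..n}. id s' = s \<and> norm (leader s - leader (Suc s))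
        \<le> (if s' = 1 then D else 2 * C1 / (\<beta> * real s'))"
      using leader_stable diam leader_in assms by auto
  qed (use beta_pos G_nonneg D_nonneg in auto)
  also have "\<dots> = D + (\<Sum>s = 2..n. 2 * C1 / (\<beta> * real s))"
    using assms by (simp add: sum.atLeast_Suc_atMost numeral_2_eq_2)
  also have "\<dots> = D + 2 * C1 / \<beta> * (\<Sum>s = 2..n. 1 / real s)"
    by (simp add: sum_distrib_left)
  also have "\<dots> \<le> D + 2 * C1 / \<beta> * ln (real n)"
    by (intro add_left_mono mult_left_mono[OF _ k] sum_inverse_le_ln assms)
  finally show ?thesis .
qed

end

section \<open>Counting arguments for the delays\<close>

text \<open>\<open>c s\<close> is the round whose gradient is processed at counter value
  \<open>s\<close>, and \<open>m\<close> is the number of gradients that arrive by round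
  \<open>T\<close>. The assumption \<open>window\<close> places \<open>s\<close> among the counter
  values of the arrival round of \<open>c s\<close>.\<close>

locale delayed_schedule =
  fixes T :: nat and d \<tau> c :: "nat \<Rightarrow> nat" and dmax m :: nat
  assumes d_ge: "\<And>t. t \<in> {1..T} \<Longrightarrow> 1 \<le> d t" and d_le: "\<And>t. t \<in> {1..T} \<Longrightarrow> d t \<le> dmax"
    and m_def: "Suc m = \<tau> (T + 1)" and tau_1: "\<tau> 1 = 1"
    and tau_mono: "\<And>a b. 1 \<le> a \<Longrightarrow> a \<le> b \<Longrightarrow> b \<le> T + 1 \<Longrightarrow> \<tau> a \<le> \<tau> b"
    and bij_c: "bij_betw c {1..m} {k \<in> {1..T}. k + d k - 1 \<le> T}"
    and window: "\<And>s. s \<in> {1..m} \<Longrightarrow> \<tau> (c s + d (c s) - 1) \<le> s \<and> s < \<tau> (c s + d (c s) - 1 + 1)"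
begin

lemma c_in: "s \<in> {1..m} \<Longrightarrow> c s \<in> {1..T} \<and> c s + d (c s) - 1 \<le> T"
  using bij_betwE[OF bij_c] by auto

lemma m_le: "m \<le> T"
proof -
  have "card {k \<in> {1..T}. k + d k - 1 \<le> T} \<le> card {1..T}" by (intro card_mono) auto
  then show ?thesis using bij_betw_same_card[OF bij_c] by simp
qed

lemma tau_le: "t \<in> {1..T} \<Longrightarrow> \<tau> t \<in> {1..m + 1}"
  using tau_mono[of 1 t] tau_mono[of t "T + 1"] tau_1 m_def by auto

lemma tau_c_le:
  assumes "s \<in> {1..m}"
  shows "\<tau> (c s) \<le> s"
proof -
  have "\<tau> (c s) \<le> \<tau> (c s + d (c s) - 1)"
    using c_in[OF assms] d_ge[of "c s"] by (intro tau_mono) auto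
  then show ?thesis using window[OF assms] by simp
qed

text \<open>The gradients of rounds up to \<open>t - dmax\<close> arrive before round
  \<open>t\<close>, so the counter has already passed that many values. The subtraction truncates
  for \<open>t <= dmax\<close>.\<close>

lemma tau_ge:
  assumes "t \<in> {1..T}"
  shows "t - dmax < \<tau> t"
proof -
  have "{1..t - dmax} \<subseteq> c ` {1..<\<tau> t}"
  proof
    fix k assume k: "k \<in> {1..t - dmax}"
    then have kT: "k \<in> {1..T}" using assms by auto
    then have "k + d k - 1 < t" using k d_le[of k] by auto
    then have "k \<in> c ` {1..m}" using kT assms bij_betw_imp_surj_on[OF bij_c] by auto
    then obtain s where s: "s \<in> {1..m}" "k = c s" by auto
    have "s < \<tau> (k + d k - 1 + 1)" using window[OF s(1)] s(2) by simp
    also have "\<dots> \<le> \<tau> t" using \<open>k + d k - 1 < t\<close> assms by (intro tau_mono) auto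
    finally show "k \<in> c ` {1..<\<tau> t}" using s by auto
  qed
  then have "card {1..t - dmax} \<le> card {1..<\<tau> t}" by (rule surj_card_le[rotated]) simp
  then show ?thesis using tau_le[OF assms] by auto
qed

text \<open>A gradient that arrives after round \<open>T\<close> belongs to one of the last
  \<open>dmax\<close> rounds.\<close>

lemma card_missing: "card ({1..T} - {k \<in> {1..T}. k + d k - 1 \<le> T}) \<le> dmax"
proof -
  have "{1..T} - {k \<in> {1..T}. k + d k - 1 \<le> T} \<subseteq> {T - dmax<..T}"
    using d_le by fastforce
  then have "card ({1..T} - {k \<in> {1..T}. k + d k - 1 \<le> T}) \<le> card {T - dmax<..T}"
    by (rule card_mono[rotated]) simp
  then show ?thesis by simp
qed

text \<open>Let \<open>r\<close> be the round in which counter value \<open>i\<close> is processed.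
  Each counted \<open>s\<close> has \<open>c s\<close> played no later than \<open>r\<close> and
  arriving no earlier than \<open>r\<close>, so \<open>c s\<close> is one of the \<open>dmax\<close>
  rounds ending at \<open>r\<close>; and \<open>c\<close> is injective.\<close>

lemma card_straddling:
  assumes i: "i \<in> {1..m}"
  shows "card {s \<in> {1..m}. \<tau> (c s) \<le> i \<and> i < s} \<le> dmax"
proof -
  define r where "r = c i + d (c i) - 1"
  have r: "\<tau> r \<le> i" "i < \<tau> (r + 1)" "r \<le> T" "1 \<le> r"
    using window[OF i] c_in[OF i] d_ge[of "c i"] by (auto simp: r_def)
  have "c ` {s \<in> {1..m}. \<tau> (c s) \<le> i \<and> i < s} \<subseteq> {r - dmax<..r}"
  proof (intro image_subsetI)
    fix s assume "s \<in> {s \<in> {1..m}. \<tau> (c s) \<le> i \<and> i < s}"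
    then have s: "s \<in> {1..m}" "\<tau> (c s) \<le> i" "i < s" by auto
    have cs: "c s \<in> {1..T}" "c s + d (c s) - 1 \<le> T" using c_in[OF s(1)] by auto
    have "c s \<le> r"
      using tau_mono[of "r + 1" "c s"] cs s r by (cases "c s \<le> r") auto
    moreover have "r \<le> c s + d (c s) - 1"
    proof (rule ccontr)
      assume "\<not> ?thesis"
      then have "\<tau> (c s + d (c s) - 1 + 1) \<le> \<tau> r" using r by (intro tau_mono) auto
      then show False using window[OF s(1)] s r by simp
    qed
    ultimately show "c s \<in> {r - dmax<..r}" using d_le[OF cs(1)] d_ge[OF cs(1)] cs by auto
  qed
  moreover have "inj_on c {s \<in> {1..m}. \<tau> (c s) \<le> i \<and> i < s}"
    using bij_c by (auto simp: bij_betw_def intro: inj_on_subset)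
  ultimately have "card {s \<in> {1..m}. \<tau> (c s) \<le> i \<and> i < s} \<le> card {r - dmax<..r}"
    by (intro card_inj_on_le) auto
  then show ?thesis by simp
qed

end

section \<open>From a run of the algorithm to its schedule\<close>

text \<open>Concatenates the processing orders of the rounds into one enumeration \<open>c\<close>.
  The bound \<open>N\<close> exists for the induction over rounds; \<open>N = T\<close> is the case
  of interest.\<close>

lemma delayed_ofw_run_schedule:
  assumes run: "delayed_ofw_run \<beta> K T d f' x y gb v \<sigma> \<tau>"
    and d_ge: "\<And>t. t \<in> {1..T} \<Longrightarrow> 1 \<le> d t" and "N \<le> T"
  shows "\<exists>c. bij_betw c {1..<\<tau> (N + 1)} {k \<in> {1..T}. k + d k - 1 \<le> N} \<and>
    (\<forall>s\<in>{1..<\<tau> (N + 1)}. ofw_step \<beta> K y gb v \<sigma> s (f' (c s) (x (c s))) \<and>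
       \<tau> (c s + d (c s) - 1) \<le> s \<and> s < \<tau> (c s + d (c s) - 1 + 1)) \<and> 1 \<le> \<tau> (N + 1)"
  using \<open>N \<le> T\<close>
proof (induction N)
  case 0
  \<comment> \<open>Delays of at least 1 exclude an arrival in round 0.\<close>
  have "{k \<in> {1..T}. k + d k - 1 \<le> 0} = {}" using d_ge by force
  then show ?case using run by (auto simp: delayed_ofw_run_def bij_betw_def)
next
  case (Suc N)
  let ?t = "N + 1" and ?A = "\<lambda>N. {k \<in> {1..T}. k + d k - 1 \<le> N}"
  from Suc obtain c where c: "bij_betw c {1..<\<tau> ?t} (?A N)"
    "\<And>s. s \<in> {1..<\<tau> ?t} \<Longrightarrow> ofw_step \<beta> K y gb v \<sigma> s (f' (c s) (x (c s))) \<and>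
       \<tau> (c s + d (c s) - 1) \<le> s \<and> s < \<tau> (c s + d (c s) - 1 + 1)" "1 \<le> \<tau> ?t"
    by auto
  have "?t \<in> {1..T}" using Suc.prems by simp
  then obtain ks where ks: "distinct ks" "set ks = arrivals T d ?t"
    "\<And>j. j < length ks \<Longrightarrow> ofw_step \<beta> K y gb v \<sigma> (\<tau> ?t + j) (f' (ks ! j) (x (ks ! j)))"
    "\<tau> (?t + 1) = \<tau> ?t + length ks"
    using run unfolding delayed_ofw_run_def by blast
  \<comment> \<open>Extends \<open>c\<close> by the list of the current round, whose
    \<open>j\<close>-th entry is processed at counter value \<open>\<tau> ?t + j\<close>.\<close>
  define c' where "c' s = (if s < \<tau> ?t then c s else ks ! (s - \<tau> ?t))" for s
  have "bij_betw c' {1..<\<tau> ?t} (?A N)"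
    using c(1) by (rule bij_betw_cong[THEN iffD1, rotated]) (simp add: c'_def)
  moreover have "bij_betw c' {\<tau> ?t..<\<tau> (?t + 1)} (arrivals T d ?t)"
  proof -
    have "bij_betw (\<lambda>s. s - \<tau> ?t) {\<tau> ?t..<\<tau> (?t + 1)} {..<length ks}"
      by (rule bij_betwI[where g = "\<lambda>j. j + \<tau> ?t"]) (use ks(4) in auto)
    moreover have "bij_betw ((!) ks) {..<length ks} (arrivals T d ?t)"
      using ks by (intro bij_betw_nth) auto
    ultimately have "bij_betw ((!) ks \<circ> (\<lambda>s. s - \<tau> ?t)) {\<tau> ?t..<\<tau> (?t + 1)} (arrivals T d ?t)"
      by (rule bij_betw_trans)
    then show ?thesis by (rule bij_betw_cong[THEN iffD1, rotated]) (simp add: c'_def)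
  qed
  moreover have "?A N \<inter> arrivals T d ?t = {}" by (auto simp: arrivals_def)
  ultimately have "bij_betw c' ({1..<\<tau> ?t} \<union> {\<tau> ?t..<\<tau> (?t + 1)}) (?A N \<union> arrivals T d ?t)"
    by (rule bij_betw_combine)
  moreover have "?A N \<union> arrivals T d ?t = ?A (Suc N)" by (auto simp: arrivals_def)
  moreover have "{1..<\<tau> ?t} \<union> {\<tau> ?t..<\<tau> (?t + 1)} = {1..<\<tau> (?t + 1)}"
    using c(3) ks(4) by auto
  ultimately have "bij_betw c' {1..<\<tau> (Suc N + 1)} (?A (Suc N))" by simp
  moreover have "ofw_step \<beta> K y gb v \<sigma> s (f' (c' s) (x (c' s))) \<and>
      \<tau> (c' s + d (c' s) - 1) \<le> s \<and> s < \<tau> (c' s + d (c' s) - 1 + 1)"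
    if s: "s \<in> {1..<\<tau> (Suc N + 1)}" for s
  proof (cases "s < \<tau> ?t")
    case True
    then show ?thesis using c(2)[of s] s by (simp add: c'_def)
  next
    case False
    define j where "j = s - \<tau> ?t"
    have j: "j < length ks" "s = \<tau> ?t + j" using s False ks(4) by (auto simp: j_def)
    have "ks ! j \<in> arrivals T d ?t" using j ks(2) nth_mem by blast
    then have "ks ! j + d (ks ! j) - 1 = ?t" by (simp add: arrivals_def)
    then show ?thesis using ks(3)[OF j(1)] ks(4) j by (simp add: c'_def)
  qed
  moreover have "1 \<le> \<tau> (Suc N + 1)" using c(3) ks(4) by simp
  ultimately show ?case by blast
qed

section \<open>Sums over delayed indices\<close>

text \<open>Double counting: after exchanging the sums, \<open>\<delta> i\<close> occurs once for
  each \<open>s\<close> whose interval contains \<open>i\<close>.\<close>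

lemma sum_card_crossing:
  fixes \<delta> :: "nat \<Rightarrow> real"
  assumes "\<And>i. 0 \<le> \<delta> i" "\<And>s. s \<in> {1..m} \<Longrightarrow> 1 \<le> a s"
    and "\<And>i. i \<in> {1..m} \<Longrightarrow> card {s \<in> {1..m}. a s \<le> i \<and> i < s} \<le> n"
  shows "(\<Sum>s = 1..m. \<Sum>i = a s..<s. \<delta> i) \<le> real n * (\<Sum>i = 1..m. \<delta> i)"
proof -
  have "(\<Sum>s = 1..m. \<Sum>i = a s..<s. \<delta> i) = (\<Sum>s = 1..m. \<Sum>i | i \<in> {1..m} \<and> a s \<le> i \<and> i < s. \<delta> i)"
    using assms(2) by (intro sum.cong refl) fastforce
  also have "\<dots> = (\<Sum>i = 1..m. \<Sum>s | s \<in> {1..m} \<and> a s \<le> i \<and> i < s. \<delta> i)"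
    by (rule sum.swap_restrict) auto
  also have "\<dots> \<le> (\<Sum>i = 1..m. real n * \<delta> i)"
    using assms by (intro sum_mono) (simp add: mult_right_mono)
  finally show ?thesis by (simp add: sum_distrib_left)
qed

text \<open>The distance bound for round \<open>t\<close> is available only with the shift
  \<open>t - n\<close>; the first \<open>n\<close> rounds are charged to the diameter.\<close>

lemma sum_powr_shifted_le:
  fixes k D :: real
  assumes "0 \<le> k" "0 \<le> D"
  shows "(\<Sum>t = 1..T. if t \<le> n then D else k * real (t - n) powr (- 1 / 3))
    \<le> real n * D + k * (3 / 2 * real T powr (2 / 3))"
proof -
  have "(\<Sum>t = 1..T. if t \<le> n then D else k * real (t - n) powr (- 1 / 3))
      = (\<Sum>t | t \<in> {1..T} \<and> t \<le> n. D) + (\<Sum>t | t \<in> {1..T} \<and> \<not> t \<le> n. k * real (t - n) powr (- 1 / 3))"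
    by (subst sum.If_cases) (simp_all add: Int_def)
  also have "(\<Sum>t | t \<in> {1..T} \<and> t \<le> n. D) \<le> real n * D"
  proof -
    have "card {t. t \<in> {1..T} \<and> t \<le> n} \<le> card {1..n}" by (intro card_mono) auto
    then show ?thesis using \<open>0 \<le> D\<close> by (simp add: mult_right_mono)
  qed
  also have "(\<Sum>t | t \<in> {1..T} \<and> \<not> t \<le> n. k * real (t - n) powr (- 1 / 3))
      = (\<Sum>j = 1..T - n. k * real j powr (- 1 / 3))"
    by (rule sum.reindex_bij_witness[of _ "\<lambda>j. j + n" "\<lambda>t. t - n"]) auto
  also have "\<dots> = k * (\<Sum>j = 1..T - n. real j powr (- 1 / 3))" by (simp add: sum_distrib_left)
  also have "\<dots> \<le> k * (3 / 2 * real T powr (2 / 3))"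
    using sum_powr_minus_third_le[of "T - n"] powr_mono2[of "2 / 3" "real (T - n)" "real T"] assms
    by (intro mult_left_mono) auto
  finally show ?thesis by simp
qed

section \<open>Assembly of the regret bound\<close>

theorem theorem2:
  fixes K :: "'a::euclidean_space set"
    and f :: "nat \<Rightarrow> 'a \<Rightarrow> real" and f' :: "nat \<Rightarrow> 'a \<Rightarrow> 'a"
    and T :: nat and d :: "nat \<Rightarrow> nat" and dmax :: nat
    and D G \<beta> C1 C2 :: real
    and x y gb v :: "nat \<Rightarrow> 'a" and \<sigma> :: "nat \<Rightarrow> real" and \<tau> :: "nat \<Rightarrow> nat"
    and xstar :: 'a
  assumes "T \<ge> 1"
    and "closed K" and "convex K" and "0 \<in> K"
    and "\<And>p q. p \<in> K \<Longrightarrow> q \<in> K \<Longrightarrow> norm (p - q) \<le> D"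
    and "\<beta> > 0"
    and "\<And>t p. t \<in> {1..T} \<Longrightarrow> p \<in> K \<Longrightarrow> has_gradient (f t) (f' t p) (at p within K)"
    and "\<And>t. t \<in> {1..T} \<Longrightarrow> strongly_convex_on \<beta> K (f t) (f' t)"
    and "\<And>t p. t \<in> {1..T} \<Longrightarrow> p \<in> K \<Longrightarrow> norm (f' t p) \<le> G"
    and "\<And>t. t \<in> {1..T} \<Longrightarrow> d t \<ge> 1"
    and "dmax = Max (d ` {1..T})"
    and "delayed_ofw_run \<beta> K T d f' x y gb v \<sigma> \<tau>"
    and "xstar \<in> K"
    and "C1 = G + \<beta> * D"
    and "C2 = G + 2 * \<beta> * D"
  shows "(\<Sum>t = 1..T. f t (x t)) - (\<Sum>t = 1..T. f t xstar)
     \<le> 6 * sqrt 2 * C2 * (C1 + 2 * C2) * real T powr (2 / 3) / \<beta>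
       + 2 * C2\<^sup>2 * ln (real T) / \<beta>
       + C1 * D
       + (C1 + C2) * (3 * real dmax * D + 4 * sqrt 2 * real dmax * C2 / \<beta>
                      + 2 * real dmax * C1 / \<beta> * ln (real T))"
proof -
  note T = assms(1) and diam = assms(5) and beta = assms(6) and sc = assms(8) and grad = assms(9)
    and d_ge = assms(10) and run = assms(12) and xstar = assms(13)
  have d_le: "d t \<le> dmax" if "t \<in> {1..T}" for t
    using that by (simp add: assms(11))
  define m where "m = \<tau> (T + 1) - 1"
  have tau_1: "\<tau> 1 = 1" and y_1: "y 1 \<in> K" and gb_0: "gb 0 = 0"
    using run unfolding delayed_ofw_run_def by blast+
  have x_eq: "x t = y (\<tau> t)" and tau_Suc: "\<tau> t \<le> \<tau> (t + 1)" if "t \<in> {1..T}" for t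
    using run that unfolding delayed_ofw_run_def by (blast, metis le_add1)
  have tau_mono: "\<tau> a \<le> \<tau> b" if "1 \<le> a" "a \<le> b" "b \<le> T + 1" for a b
    using that(2,1,3) by (induction b rule: dec_induct) (auto intro: order_trans[OF _ tau_Suc[simplified]])
  obtain c where c: "bij_betw c {1..<\<tau> (T + 1)} {k \<in> {1..T}. k + d k - 1 \<le> T}"
    and steps: "\<And>s. s \<in> {1..<\<tau> (T + 1)} \<Longrightarrow> ofw_step \<beta> K y gb v \<sigma> s (f' (c s) (x (c s))) \<and>
       \<tau> (c s + d (c s) - 1) \<le> s \<and> s < \<tau> (c s + d (c s) - 1 + 1)" and "1 \<le> \<tau> (T + 1)"
    using delayed_ofw_run_schedule[OF run d_ge order_refl] by auto
  then have m: "Suc m = \<tau> (T + 1)" "{1..<\<tau> (T + 1)} = {1..m}" by (auto simp: m_def)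
  interpret delayed_schedule T d \<tau> c dmax m
    using c steps m d_ge d_le tau_1 tau_mono by unfold_locales auto
  have G: "0 \<le> G"
    using grad[of 1 0] assms(4) T order_trans[OF norm_ge_zero[of "f' 1 0"]] by simp
  define u where "u s = f' (c s) (x (c s))" for s
  have step: "ofw_step \<beta> K y gb v \<sigma> s (u s)" if "s \<in> {1..m}" for s
    using steps[of s] that unfolding m(2) u_def by blast
  have x_in: "x t \<in> K" if "t \<in> {1..T}" for t
    using ofw_iterate_in[OF assms(3) y_1 step tau_le[OF that]] x_eq[OF that] by simp
  interpret ofw_trajectory \<beta> D G K m y gb v u \<sigma>
    using assms(2,3) diam beta y_1 gb_0 step grad x_in c_in G by unfold_locales (auto simp: u_def)

  let ?A = "{k \<in> {1..T}. k + d k - 1 \<le> T}"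
  define S where "S = 6 * sqrt 2 * C2 / \<beta> * real T powr (2 / 3)"
  define L where "L = 2 * C1 / \<beta> * ln (real T)"
  define reg where "reg t = f t (x t) - f t xstar" for t
  define E where "E s = norm (y s - leader s)" for s
  define \<delta> where "\<delta> s = norm (leader s - leader (Suc s))" for s
  have "0 \<le> C1" "C1 \<le> C2" "G \<le> C1" "G \<le> C2" "0 \<le> C2"
    using assms(14,15) G D_nonneg beta by auto
  have "0 \<le> S" "0 \<le> L" "0 \<le> ln (real T)"
    using \<open>0 \<le> C1\<close> \<open>0 \<le> C2\<close> beta T by (auto simp: S_def L_def)
  have sum_E: "(\<Sum>s = 1..m. E s) \<le> S"
    using sum_norm_y_leader[OF m_le] by (simp add: E_def S_def assms(15))
  have sum_\<delta>: "(\<Sum>s = 1..m. \<delta> s) \<le> D + L"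
    using sum_norm_leader_diff[OF m_le T] by (simp add: \<delta>_def L_def assms(14))

  have reg_le: "reg t \<le> inner (f' t (x t)) (x t - xstar) - \<beta> / 2 * (norm (x t - xstar))\<^sup>2"
    if "t \<in> {1..T}" for t
  proof -
    have "f t xstar \<ge> f t (x t) + inner (f' t (x t)) (xstar - x t) + \<beta> / 2 * (norm (xstar - x t))\<^sup>2"
      using sc[OF that] x_in[OF that] xstar by (simp add: strongly_convex_on_def)
    then show ?thesis by (simp add: reg_def inner_diff_right norm_minus_commute)
  qed

  have missing: "(\<Sum>t\<in>{1..T} - ?A. reg t) \<le> real dmax * (G * D)"
  proof -
    have "reg t \<le> G * D" if "t \<in> {1..T} - ?A" for t
    proof -
      have t: "t \<in> {1..T}" using that by simp
      have "inner (f' t (x t)) (x t - xstar) \<le> norm (f' t (x t)) * norm (x t - xstar)"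
        by (rule norm_cauchy_schwarz)
      also have "\<dots> \<le> G * D"
        using grad[OF t x_in[OF t]] diam[OF x_in[OF t] xstar] G by (intro mult_mono) auto
      moreover have "0 \<le> \<beta> / 2 * (norm (x t - xstar))\<^sup>2" using beta by simp
      ultimately show ?thesis using reg_le[OF t] by linarith
    qed
    then have "(\<Sum>t\<in>{1..T} - ?A. reg t) \<le> real (card ({1..T} - ?A)) * (G * D)"
      by (rule sum_bounded_above)
    also have "\<dots> \<le> real dmax * (G * D)"
      using card_missing G D_nonneg by (intro mult_right_mono) auto
    finally show ?thesis .
  qed

  \<comment> \<open>Triangle inequality from the played iterate through its leader and the current
    leader to \<open>y s\<close>.\<close>
  have played: "norm (x (c s) - y s) \<le> E s + E (\<tau> (c s)) + (\<Sum>i = \<tau> (c s)..<s. \<delta> i)"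
    if s: "s \<in> {1..m}" for s
  proof -
    have "norm (x (c s) - y s) \<le> norm (y (\<tau> (c s)) - leader (\<tau> (c s)))
        + norm (leader (\<tau> (c s)) - leader s) + norm (leader s - y s)"
      using norm_triangle_ineq[of "y (\<tau> (c s)) - leader (\<tau> (c s))" "leader (\<tau> (c s)) - y s"]
        norm_triangle_ineq[of "leader (\<tau> (c s)) - leader s" "leader s - y s"]
        x_eq[of "c s"] c_in[OF s] by simp
    then show ?thesis
      using norm_leader_diff_le[OF tau_c_le[OF s]] by (simp add: E_def \<delta>_def norm_minus_commute)
  qed

  have sum_E_played: "(\<Sum>s = 1..m. E (\<tau> (c s))) \<le> real dmax * D + S"
  proof -
    let ?k = "4 * sqrt 2 * C2 / \<beta>"
    have "0 \<le> ?k" using \<open>0 \<le> C2\<close> beta by simp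
    have "(\<Sum>s = 1..m. E (\<tau> (c s))) = (\<Sum>t\<in>?A. E (\<tau> t))"
      by (rule sum.reindex_bij_betw[OF bij_c])
    also have "\<dots> \<le> (\<Sum>t = 1..T. E (\<tau> t))"
      by (rule sum_mono2) (auto simp: E_def)
    also have "\<dots> \<le> (\<Sum>t = 1..T. if t \<le> dmax then D else ?k * real (t - dmax) powr (- 1 / 3))"
    proof (rule sum_mono)
      fix t assume t: "t \<in> {1..T}"
      show "E (\<tau> t) \<le> (if t \<le> dmax then D else ?k * real (t - dmax) powr (- 1 / 3))"
      proof (cases "t \<le> dmax")
        case True
        then show ?thesis using diam[OF y_in[OF tau_le[OF t]] leader_in] by (simp add: E_def)
      next
        case False
        \<comment> \<open>The iterate \<open>y (Suc s)\<close> is the result of \<open>s\<close>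
          steps, and \<open>tau_ge\<close> gives \<open>s >= t - dmax\<close>; the negative power is
          decreasing, so passing to \<open>t - dmax\<close> enlarges the bound.\<close>
        define s where "s = \<tau> t - 1"
        have s: "s \<in> {1..m}" "\<tau> t = Suc s" "t - dmax \<le> s"
          using tau_ge[OF t] tau_le[OF t] False by (auto simp: s_def)
        have "E (\<tau> t) \<le> ?k * real s powr (- 1 / 3)"
          using norm_y_leader[OF s(1)] by (simp add: E_def s(2) assms(15))
        also have "\<dots> \<le> ?k * real (t - dmax) powr (- 1 / 3)"
          using s(3) False \<open>0 \<le> ?k\<close> by (intro mult_left_mono powr_mono2') auto
        finally show ?thesis using False by simp
      qed
    qed
    also have "\<dots> \<le> real dmax * D + ?k * (3 / 2 * real T powr (2 / 3))"
      using \<open>0 \<le> ?k\<close> D_nonneg by (rule sum_powr_shifted_le)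
    finally show ?thesis by (simp add: S_def mult_ac)
  qed

  have sum_\<delta>_delay: "(\<Sum>s = 1..m. \<Sum>i = \<tau> (c s)..<s. \<delta> i) \<le> real dmax * (D + L)"
  proof -
    have "(\<Sum>s = 1..m. \<Sum>i = \<tau> (c s)..<s. \<delta> i) \<le> real dmax * (\<Sum>i = 1..m. \<delta> i)"
    proof (rule sum_card_crossing[where a = "\<lambda>s. \<tau> (c s)"])
      show "1 \<le> \<tau> (c s)" if "s \<in> {1..m}" for s
        using tau_le[OF conjunct1[OF c_in[OF that]]] by simp
      show "card {s \<in> {1..m}. \<tau> (c s) \<le> i \<and> i < s} \<le> dmax" if "i \<in> {1..m}" for i
        using that by (rule card_straddling)
    qed (simp add: \<delta>_def)
    also have "\<dots> \<le> real dmax * (D + L)" using sum_\<delta> by (intro mult_left_mono) auto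
    finally show ?thesis .
  qed

  have "(\<Sum>t\<in>?A. reg t) = (\<Sum>s = 1..m. reg (c s))"
    by (rule sum.reindex_bij_betw[OF bij_c, symmetric])
  also have "\<dots> \<le> (\<Sum>s = 1..m. (inner (u s) (y s - xstar) - \<beta> / 2 * (norm (y s - xstar))\<^sup>2)
      + C1 * (E s + E (\<tau> (c s)) + (\<Sum>i = \<tau> (c s)..<s. \<delta> i)))"
  proof (rule sum_mono)
    fix s assume s: "s \<in> {1..m}"
    have "c s \<in> {1..T}" using c_in[OF s] by simp
    have "y s \<in> K" using s by (intro y_in) auto
    have "reg (c s) \<le> inner (u s) (x (c s) - xstar) - \<beta> / 2 * (norm (x (c s) - xstar))\<^sup>2"
      using reg_le[OF \<open>c s \<in> {1..T}\<close>] by (simp add: u_def)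
    also have "\<dots> \<le> inner (u s) (y s - xstar) - \<beta> / 2 * (norm (y s - xstar))\<^sup>2
        + C1 * norm (x (c s) - y s)"
      unfolding assms(14)
      by (rule linear_minus_quadratic_shift[OF s x_in[OF \<open>c s \<in> {1..T}\<close>] \<open>y s \<in> K\<close> xstar])
    also have "C1 * norm (x (c s) - y s) \<le> C1 * (E s + E (\<tau> (c s)) + (\<Sum>i = \<tau> (c s)..<s. \<delta> i))"
      using played[OF s] \<open>0 \<le> C1\<close> by (rule mult_left_mono)
    finally show "reg (c s) \<le> (inner (u s) (y s - xstar) - \<beta> / 2 * (norm (y s - xstar))\<^sup>2)
      + C1 * (E s + E (\<tau> (c s)) + (\<Sum>i = \<tau> (c s)..<s. \<delta> i))" by simp
  qed
  also have "\<dots> = (\<Sum>s = 1..m. inner (u s) (y s - xstar) - \<beta> / 2 * (norm (y s - xstar))\<^sup>2)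
      + C1 * ((\<Sum>s = 1..m. E s) + (\<Sum>s = 1..m. E (\<tau> (c s)))
              + (\<Sum>s = 1..m. \<Sum>i = \<tau> (c s)..<s. \<delta> i))"
    by (simp only: sum.distrib sum_distrib_left[symmetric])
  also have "\<dots> \<le> G * (S + (D + L)) + C1 * (S + (real dmax * D + S) + real dmax * (D + L))"
  proof (rule add_mono)
    have "(\<Sum>s = 1..m. inner (u s) (y s - xstar) - \<beta> / 2 * (norm (y s - xstar))\<^sup>2)
        \<le> G * ((\<Sum>s = 1..m. E s) + (\<Sum>s = 1..m. \<delta> s))"
      using sum_loss_regret[OF xstar] by (simp add: E_def \<delta>_def)
    also have "\<dots> \<le> G * (S + (D + L))"
      using sum_E sum_\<delta> G by (intro mult_left_mono add_mono)
    finally show "(\<Sum>s = 1..m. inner (u s) (y s - xstar) - \<beta> / 2 * (norm (y s - xstar))\<^sup>2) \<le> \<dots>" .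
  qed (intro mult_left_mono add_mono sum_E sum_E_played sum_\<delta>_delay \<open>0 \<le> C1\<close>)
  finally have arrived: "(\<Sum>t\<in>?A. reg t)
      \<le> G * (S + (D + L)) + C1 * (S + (real dmax * D + S) + real dmax * (D + L))" .

  have "(\<Sum>t = 1..T. f t (x t)) - (\<Sum>t = 1..T. f t xstar) = (\<Sum>t = 1..T. reg t)"
    by (simp add: reg_def sum_subtractf)
  also have "\<dots> = (\<Sum>t\<in>{1..T} - ?A. reg t) + (\<Sum>t\<in>?A. reg t)"
    by (rule sum.subset_diff) auto
  also have "\<dots> \<le> real dmax * (G * D) + (G * (S + (D + L)) + C1 * (S + (real dmax * D + S) + real dmax * (D + L)))"
    by (rule add_mono[OF missing arrived])
  also have "\<dots> = S * (G + C1 + C1) + G * L + G * D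
      + (real dmax * D * (G + C1 + C1) + C1 * (real dmax * L))"
    by (simp add: algebra_simps)
  \<comment> \<open>Rounding up to the stated constants by \<open>G <= C1 <= C2\<close>. The summand
    with \<open>4 * sqrt 2 * real dmax\<close> is added here as nonnegative slack.\<close>
  also have "\<dots> \<le> S * (C1 + 2 * C2) + 2 * C2\<^sup>2 * ln (real T) / \<beta> + C1 * D
      + (real dmax * D * (3 * (C1 + C2)) + (C1 + C2) * (real dmax * L + 4 * sqrt 2 * real dmax * C2 / \<beta>))"
  proof (intro add_mono)
    have "G * (2 * C1) \<le> C2 * (2 * C2)"
      using \<open>G \<le> C2\<close> \<open>C1 \<le> C2\<close> \<open>0 \<le> C1\<close> \<open>0 \<le> C2\<close> by (intro mult_mono) auto
    then have "G * (2 * C1) * (ln (real T) / \<beta>) \<le> C2 * (2 * C2) * (ln (real T) / \<beta>)"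
      using beta \<open>0 \<le> ln (real T)\<close> by (intro mult_right_mono) auto
    then show "G * L \<le> 2 * C2\<^sup>2 * ln (real T) / \<beta>"
      by (simp add: L_def power2_eq_square mult_ac)
    show "C1 * (real dmax * L) \<le> (C1 + C2) * (real dmax * L + 4 * sqrt 2 * real dmax * C2 / \<beta>)"
      using \<open>0 \<le> C1\<close> \<open>0 \<le> C2\<close> \<open>0 \<le> L\<close> beta by (intro mult_mono) auto
  qed (use \<open>0 \<le> S\<close> \<open>0 \<le> C1\<close> \<open>C1 \<le> C2\<close> \<open>G \<le> C1\<close> D_nonneg in
      \<open>auto intro!: mult_left_mono mult_right_mono\<close>)
  also have "\<dots> = 6 * sqrt 2 * C2 * (C1 + 2 * C2) * real T powr (2 / 3) / \<beta>
       + 2 * C2\<^sup>2 * ln (real T) / \<beta>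
       + C1 * D
       + (C1 + C2) * (3 * real dmax * D + 4 * sqrt 2 * real dmax * C2 / \<beta>
                      + 2 * real dmax * C1 / \<beta> * ln (real T))"
    unfolding S_def L_def by (simp add: distrib_left distrib_right mult_ac)
  finally show ?thesis .
qed

end
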